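(* Consider strictly positive smooth functions $A,B$ of $(t,r)$, $t\ge0$, $r>1$, and put $x=t+r$, $y=r-t$. The general solution of the system $$\begin{cases}A=2BB_x\\ 8BB_{xx}+12B_x^2=1\end{cases}$$ is given by the expressions $$\begin{cases}A=2B\sqrt{\frac{1}{12}+\frac{f(y)}{B^3}}\\[4pt] x=\displaystyle\int_0^B\frac{db}{\sqrt{\frac{1}{12}+\frac{f(y)}{b^3}}}+h(y)\end{cases}$$ where $f(y)$ and $h(y)$ are arbitrary smooth functions. That is, $(A,B)$ solves the system if and only if it is given by these expressions for some smooth functions $f$ and $h$ of $y$.
   Context: $B_x$, $B_{xx}$ denote the first and second partial derivatives with respect to $x$ in the coordinates $(x,y)=(t+r,\,r-t)$ (that is, with $y$ held fixed). The functions $A$ and $B$ are the coefficient functions of a family of Riemannian metrics $dr^2+\sum_{i=1}^3A^2(\eta_i+\tilde\eta_i)^2+\sum_{j=1}^3B^2(\eta_j-\tilde\eta_j)^2$ on the cone $(1,\infty)\times S^3\times S^3$ ($\eta_i$, $\tilde\eta_i$ being left-invariant coframes on the two factors $S^3=SU(2)$), and for this reason are assumed strictly positive throughout.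
   Formalization: h is only required continuous, and smooth away from the frontier of the zero set of f, since smooth h can fail (f(y)=y^2, B=1 at x=0 gives h with a |y|^(2/3) term); where f(y)<0 the integral from 0 to B runs only over b with 1/12+f(y)/b^3>0. *)

theory Defs
  imports "HOL-Analysis.Analysis"
begin

text \<open>
  Smoothness on a set that need not be open: derivatives are taken within the set, so at boundary
  points they are one-sided. All sets used below are open or convex with nonempty interior, so
  these derivatives are unique.
\<close>

fun k_smooth_on :: "nat \<Rightarrow> 'a::real_normed_vector set \<Rightarrow> ('a \<Rightarrow> 'b::real_normed_vector) \<Rightarrow> bool" where
  "k_smooth_on 0 S f \<longleftrightarrow> continuous_on S f"
| "k_smooth_on (Suc k) S f \<longleftrightarrow>
     (\<exists>f'. (\<forall>x\<in>S. (f has_derivative f' x) (at x within S)) \<and>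
           (\<forall>v. k_smooth_on k S (\<lambda>x. f' x v)))"

definition smooth_on :: "'a::real_normed_vector set \<Rightarrow> ('a \<Rightarrow> 'b::real_normed_vector) \<Rightarrow> bool" where
  "smooth_on S f \<longleftrightarrow> (\<forall>k. k_smooth_on k S f)"

definition tr_domain :: "(real \<times> real) set" where
  "tr_domain = {(t, r). 0 \<le> t \<and> 1 < r}"

text \<open>
  Functions take the pair \<open>(t, r)\<close>. In the coordinates \<open>x = t + r\<close>, \<open>y = r - t\<close> this is the point
  \<open>((x - y) / 2, (x + y) / 2)\<close>.
\<close>

definition tr_of_xy :: "real \<Rightarrow> real \<Rightarrow> real \<times> real" where
  "tr_of_xy x y = ((x - y) / 2, (x + y) / 2)"

text \<open>
  The partial derivative in \<open>x\<close> with \<open>y\<close> held fixed; one-sided where the line of constant \<open>y\<close> starts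
  on the boundary \<open>t = 0\<close>.
\<close>

definition x_deriv :: "(real \<times> real \<Rightarrow> real) \<Rightarrow> real \<times> real \<Rightarrow> real" where
  "x_deriv F = (\<lambda>(t, r). vector_derivative (\<lambda>x. F (tr_of_xy x (r - t)))
     (at (t + r) within {x. tr_of_xy x (r - t) \<in> tr_domain}))"

definition solves_system :: "(real \<times> real \<Rightarrow> real) \<Rightarrow> (real \<times> real \<Rightarrow> real) \<Rightarrow> bool" where
  "solves_system A B \<longleftrightarrow> (\<forall>p\<in>tr_domain.
     A p = 2 * B p * x_deriv B p \<and>
     8 * B p * x_deriv (x_deriv B) p + 12 * (x_deriv B p)\<^sup>2 = 1)"

text \<open>
  The integral of \<open>1 / sqrt (1/12 + c / b^3)\<close> over \<open>0 < b \<le> \<beta>\<close>. For \<open>c \<ge> 0\<close> the radicand is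
  positive on the whole range. For \<open>c < 0\<close> it is negative for small \<open>b\<close>; the integral then
  extends over the part of the range where the integrand is real.
\<close>

definition profile_integral :: "real \<Rightarrow> real \<Rightarrow> real" where
  "profile_integral c \<beta> =
     integral {b. 0 < b \<and> b \<le> \<beta> \<and> 1/12 + c / b ^ 3 > 0} (\<lambda>b. 1 / sqrt (1/12 + c / b ^ 3))"

definition given_by ::
  "(real \<Rightarrow> real) \<Rightarrow> (real \<Rightarrow> real) \<Rightarrow> (real \<times> real \<Rightarrow> real) \<Rightarrow> (real \<times> real \<Rightarrow> real) \<Rightarrow> bool" where
  "given_by f h A B \<longleftrightarrow> (\<forall>(t, r)\<in>tr_domain.
     A (t, r) = 2 * B (t, r) * sqrt (1/12 + f (r - t) / B (t, r) ^ 3) \<and>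
     t + r = profile_integral (f (r - t)) (B (t, r)) + h (r - t))"

text \<open>
  As \<open>c\<close> tends to \<open>0\<close>, \<open>profile_integral c \<beta>\<close> differs from \<open>sqrt 12 * \<beta>\<close> by a nonzero multiple of
  \<open>\<bar>c\<bar> powr (1/3)\<close> to leading order. Hence \<open>h\<close> need not be differentiable at a point where \<open>f\<close>
  acquires a zero, even if \<open>A\<close>, \<open>B\<close> and \<open>f\<close> are smooth: take \<open>f y = y\<^sup>2\<close> and the solution \<open>B\<close>
  equal to \<open>1\<close> on the line \<open>x = 0\<close>. So \<open>h\<close> is only required to be continuous, and smooth away
  from the frontier of the zero set of \<open>f\<close>. This frontier is empty, and \<open>h\<close> is smooth on the
  whole line, if \<open>f\<close> has no zeros or vanishes identically.
\<close>

definition admissible_data :: "(real \<Rightarrow> real) \<Rightarrow> (real \<Rightarrow> real) \<Rightarrow> bool" where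
  "admissible_data f h \<longleftrightarrow>
     smooth_on UNIV f \<and> continuous_on UNIV h \<and> smooth_on (- frontier {y. f y = 0}) h"

end

theory Submission
  imports Defs
begin

text \<open>
  Along a line of constant \<open>y\<close> the second equation of the system says that
  \<open>B\<^sup>3 (B\<^sub>x\<^sup>2 - 1/12)\<close> is conserved; its value is \<open>f y\<close>. Since \<open>B\<^sub>x\<close> is positive, this is the
  separable equation \<open>B\<^sub>x = sqrt (1/12 + f y / B\<^sup>3)\<close>, whose integration constant is \<open>h y\<close>. For the
  regularity of \<open>h\<close>, the scaling \<open>P (k\<^sup>3 c) (k b) = k P c b\<close> of the profile integral \<open>P\<close> reduces
  \<open>c \<noteq> 0\<close> to \<open>c = 1\<close> and \<open>c = - 1\<close>, where \<open>P c\<close> is an antiderivative of a smooth function, and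
  \<open>P c s / s \<longlongrightarrow> sqrt 12\<close> as \<open>s \<longlongrightarrow> \<infinity>\<close> gives continuity where \<open>f\<close> vanishes.
\<close>

section \<open>Calculus of smooth functions\<close>

lemma k_smooth_on_SucI:
  "(\<And>x. x \<in> S \<Longrightarrow> (f has_derivative f' x) (at x within S)) \<Longrightarrow>
    (\<And>v. k_smooth_on k S (\<lambda>x. f' x v)) \<Longrightarrow> k_smooth_on (Suc k) S f"
  unfolding k_smooth_on.simps by blast

lemma k_smooth_on_SucE:
  assumes "k_smooth_on (Suc k) S f"
  obtains f' where "\<And>x. x \<in> S \<Longrightarrow> (f has_derivative f' x) (at x within S)"
    "\<And>v. k_smooth_on k S (\<lambda>x. f' x v)"
  using assms unfolding k_smooth_on.simps by blast

lemma k_smooth_on_cong: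
  assumes "\<And>x. x \<in> S \<Longrightarrow> f x = g x" "k_smooth_on k S f"
  shows "k_smooth_on k S g"
proof (cases k)
  case 0
  then show ?thesis using assms by (simp cong: continuous_on_cong)
next
  case (Suc j)
  obtain f' where f: "\<And>x. x \<in> S \<Longrightarrow> (f has_derivative f' x) (at x within S)"
    "\<And>v. k_smooth_on j S (\<lambda>x. f' x v)"
    using assms(2) unfolding Suc by (rule k_smooth_on_SucE) (rule that)
  have "(g has_derivative f' x) (at x within S)" if "x \<in> S" for x
    using has_derivative_transform[OF that _ f(1)[OF that]] assms(1) by simp
  then show ?thesis unfolding Suc by (rule k_smooth_on_SucI[OF _ f(2)])
qed

lemma k_smooth_on_subset:
  "k_smooth_on k S f \<Longrightarrow> T \<subseteq> S \<Longrightarrow> k_smooth_on k T f"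
proof (induction k arbitrary: f)
  case 0
  then show ?case by (auto intro: continuous_on_subset)
next
  case (Suc k)
  from Suc.prems(1) obtain f' where f: "\<And>x. x \<in> S \<Longrightarrow> (f has_derivative f' x) (at x within S)"
    "\<And>v. k_smooth_on k S (\<lambda>x. f' x v)"
    by (rule k_smooth_on_SucE) (rule that)
  show ?case
  proof (rule k_smooth_on_SucI)
    show "(f has_derivative f' x) (at x within T)" if "x \<in> T" for x
      using f(1) Suc.prems(2) that has_derivative_subset by blast
    show "k_smooth_on k T (\<lambda>x. f' x v)" for v by (rule Suc.IH[OF f(2) Suc.prems(2)])
  qed
qed

lemma k_smooth_on_SucD: "k_smooth_on (Suc k) S f \<Longrightarrow> k_smooth_on k S f"
proof (induction k arbitrary: f)
  case 0
  then show ?case by (auto intro: has_derivative_continuous_on)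
next
  case (Suc k)
  from Suc.prems obtain f' where f: "\<And>x. x \<in> S \<Longrightarrow> (f has_derivative f' x) (at x within S)"
    "\<And>v. k_smooth_on (Suc k) S (\<lambda>x. f' x v)"
    by (rule k_smooth_on_SucE) (rule that)
  show ?case by (rule k_smooth_on_SucI[OF f(1) Suc.IH[OF f(2)]])
qed

lemma k_smooth_on_const: "k_smooth_on k S (\<lambda>x. c)"
proof (induction k arbitrary: c)
  case (Suc k)
  show ?case by (rule k_smooth_on_SucI[OF has_derivative_const Suc])
qed simp

lemma k_smooth_on_linear_compose:
  assumes "bounded_linear L" "k_smooth_on k S f"
  shows "k_smooth_on k S (\<lambda>x. L (f x))"
  using assms(2)
proof (induction k arbitrary: f)
  case 0
  then show ?case using assms(1) by (auto intro: bounded_linear.continuous_on)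
next
  case (Suc k)
  from Suc.prems obtain f' where f: "\<And>x. x \<in> S \<Longrightarrow> (f has_derivative f' x) (at x within S)"
    "\<And>v. k_smooth_on k S (\<lambda>x. f' x v)"
    by (rule k_smooth_on_SucE) (rule that)
  show ?case
    by (rule k_smooth_on_SucI[OF bounded_linear.has_derivative[OF assms(1) f(1)] Suc.IH[OF f(2)]])
qed

lemma k_smooth_on_id: "k_smooth_on k S (\<lambda>x. x)"
proof (cases k)
  case (Suc j)
  show ?thesis unfolding Suc by (rule k_smooth_on_SucI[OF has_derivative_ident k_smooth_on_const])
qed simp

lemma k_smooth_on_add:
  "k_smooth_on k S f \<Longrightarrow> k_smooth_on k S g \<Longrightarrow> k_smooth_on k S (\<lambda>x. f x + g x)"
proof (induction k arbitrary: f g)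
  case 0
  then show ?case by (auto intro: continuous_on_add)
next
  case (Suc k)
  from Suc.prems(1) obtain f' where f: "\<And>x. x \<in> S \<Longrightarrow> (f has_derivative f' x) (at x within S)"
    "\<And>v. k_smooth_on k S (\<lambda>x. f' x v)"
    by (rule k_smooth_on_SucE) (rule that)
  from Suc.prems(2) obtain g' where g: "\<And>x. x \<in> S \<Longrightarrow> (g has_derivative g' x) (at x within S)"
    "\<And>v. k_smooth_on k S (\<lambda>x. g' x v)"
    by (rule k_smooth_on_SucE) (rule that)
  show ?case
    by (rule k_smooth_on_SucI[OF has_derivative_add[OF f(1) g(1)] Suc.IH[OF f(2) g(2)]])
qed

lemma k_smooth_on_sum:
  "finite I \<Longrightarrow> (\<And>i. i \<in> I \<Longrightarrow> k_smooth_on k S (f i)) \<Longrightarrow> k_smooth_on k S (\<lambda>x. \<Sum>i\<in>I. f i x)"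
  by (induction I rule: finite_induct) (simp_all add: k_smooth_on_const k_smooth_on_add)

lemma k_smooth_on_scaleR:
  "k_smooth_on k S f \<Longrightarrow> k_smooth_on k S g \<Longrightarrow> k_smooth_on k S (\<lambda>x. f x *\<^sub>R g x)"
proof (induction k arbitrary: f g)
  case 0
  then show ?case by (auto intro: continuous_on_scaleR)
next
  case (Suc k)
  from Suc.prems(1) obtain f' where f: "\<And>x. x \<in> S \<Longrightarrow> (f has_derivative f' x) (at x within S)"
    "\<And>v. k_smooth_on k S (\<lambda>x. f' x v)"
    by (rule k_smooth_on_SucE) (rule that)
  from Suc.prems(2) obtain g' where g: "\<And>x. x \<in> S \<Longrightarrow> (g has_derivative g' x) (at x within S)"
    "\<And>v. k_smooth_on k S (\<lambda>x. g' x v)"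
    by (rule k_smooth_on_SucE) (rule that)
  show ?case
    by (rule k_smooth_on_SucI[OF has_derivative_scaleR[OF f(1) g(1)]
          k_smooth_on_add[OF Suc.IH[OF Suc.prems(1)[THEN k_smooth_on_SucD] g(2)]
            Suc.IH[OF f(2) Suc.prems(2)[THEN k_smooth_on_SucD]]]])
qed

text \<open>In the chain rule \<open>g' (f x) (f' x v)\<close> the direction varies with
  \<open>x\<close>, while the induction hypothesis covers only fixed directions. Expanding
  \<open>f' x v\<close> in the Euclidean basis leaves the derivatives of \<open>g\<close> in the
  fixed directions \<open>b\<close>, with scalar coefficients of the right order.\<close>

lemma k_smooth_on_compose:
  fixes f :: "'a::real_normed_vector \<Rightarrow> 'b::euclidean_space"
    and g :: "'b \<Rightarrow> 'c::real_normed_vector"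
  shows "k_smooth_on k T g \<Longrightarrow> k_smooth_on k S f \<Longrightarrow> f ` S \<subseteq> T \<Longrightarrow> k_smooth_on k S (\<lambda>x. g (f x))"
proof (induction k arbitrary: f g)
  case 0
  then show ?case by (auto intro: continuous_on_compose2)
next
  case (Suc k)
  from Suc.prems(2) obtain f' where f: "\<And>x. x \<in> S \<Longrightarrow> (f has_derivative f' x) (at x within S)"
    "\<And>v. k_smooth_on k S (\<lambda>x. f' x v)"
    by (rule k_smooth_on_SucE) (rule that)
  from Suc.prems(1) obtain g' where g: "\<And>x. x \<in> T \<Longrightarrow> (g has_derivative g' x) (at x within T)"
    "\<And>v. k_smooth_on k T (\<lambda>x. g' x v)"
    by (rule k_smooth_on_SucE) (rule that)
  have d: "((\<lambda>x. g (f x)) has_derivative (\<lambda>v. g' (f x) (f' x v))) (at x within S)" if "x \<in> S" for x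
    using has_derivative_in_compose2[OF g(1) Suc.prems(3) that f(1)[OF that]] by simp
  have e: "k_smooth_on k S (\<lambda>x. g' (f x) (f' x v))" for v
  proof (rule k_smooth_on_cong)
    show "k_smooth_on k S (\<lambda>x. \<Sum>b\<in>Basis. (f' x v \<bullet> b) *\<^sub>R g' (f x) b)"
      by (rule k_smooth_on_sum[OF finite_Basis k_smooth_on_scaleR[OF
            k_smooth_on_linear_compose[OF bounded_linear_inner_left f(2)]
            Suc.IH[OF g(2) k_smooth_on_SucD[OF Suc.prems(2)] Suc.prems(3)]]])
  next
    fix x assume x: "x \<in> S"
    then have "linear (g' (f x))"
      using g(1) Suc.prems(3) by (meson has_derivative_linear image_subset_iff)
    then have "g' (f x) (\<Sum>b\<in>Basis. (f' x v \<bullet> b) *\<^sub>R b) = (\<Sum>b\<in>Basis. (f' x v \<bullet> b) *\<^sub>R g' (f x) b)"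
      by (simp add: linear_sum linear_scale)
    then show "(\<Sum>b\<in>Basis. (f' x v \<bullet> b) *\<^sub>R g' (f x) b) = g' (f x) (f' x v)"
      by (simp add: euclidean_representation)
  qed
  show ?case by (rule k_smooth_on_SucI[OF d e])
qed

text \<open>On open sets the derivative within the set is the full derivative, hence unique, so the
  derivatives chosen on the two sets agree on the overlap and both equal
  \<open>frechet_derivative\<close>.\<close>

lemma k_smooth_on_Un:
  assumes "open S" "open T"
  shows "k_smooth_on k S f \<Longrightarrow> k_smooth_on k T f \<Longrightarrow> k_smooth_on k (S \<union> T) f"
proof (induction k arbitrary: f)
  case 0
  then show ?case using assms by (auto intro: continuous_on_open_Un)
next
  case (Suc k)
  from Suc.prems(1) obtain g where "\<And>x. x \<in> S \<Longrightarrow> (f has_derivative g x) (at x within S)"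
    and g2: "\<And>v. k_smooth_on k S (\<lambda>x. g x v)"
    by (rule k_smooth_on_SucE) (rule that)
  then have g1: "\<And>x. x \<in> S \<Longrightarrow> (f has_derivative g x) (at x)"
    using at_within_open[OF _ assms(1)] by simp
  from Suc.prems(2) obtain h where "\<And>x. x \<in> T \<Longrightarrow> (f has_derivative h x) (at x within T)"
    and h2: "\<And>v. k_smooth_on k T (\<lambda>x. h x v)"
    by (rule k_smooth_on_SucE) (rule that)
  then have h1: "\<And>x. x \<in> T \<Longrightarrow> (f has_derivative h x) (at x)"
    using at_within_open[OF _ assms(2)] by simp
  let ?f' = "\<lambda>x. frechet_derivative f (at x)"
  have eq: "\<And>x. x \<in> S \<Longrightarrow> g x = ?f' x" "\<And>x. x \<in> T \<Longrightarrow> h x = ?f' x"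
    using g1 h1 frechet_derivative_at by blast+
  have d: "(f has_derivative ?f' x) (at x within S \<union> T)" if "x \<in> S \<union> T" for x
    using that g1 h1 eq by (metis Un_iff has_derivative_at_withinI)
  have e: "k_smooth_on k (S \<union> T) (\<lambda>x. ?f' x v)" for v
  proof (rule Suc.IH)
    show "k_smooth_on k S (\<lambda>x. ?f' x v)" by (rule k_smooth_on_cong[OF _ g2[of v]]) (simp add: eq(1))
    show "k_smooth_on k T (\<lambda>x. ?f' x v)" by (rule k_smooth_on_cong[OF _ h2[of v]]) (simp add: eq(2))
  qed
  show ?case by (rule k_smooth_on_SucI[OF d e])
qed

lemma k_smooth_on_antiderivative:
  fixes g :: "real \<Rightarrow> real"
  assumes "\<And>x. x \<in> S \<Longrightarrow> (g has_real_derivative g' x) (at x within S)" "k_smooth_on k S g'"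
  shows "k_smooth_on (Suc k) S g"
proof -
  have "(g has_derivative (\<lambda>v. v *\<^sub>R g' x)) (at x within S)" if "x \<in> S" for x
    using assms(1)[OF that] by (simp add: has_field_derivative_def mult_commute_abs)
  then show ?thesis
    by (rule k_smooth_on_SucI[OF _ k_smooth_on_scaleR[OF k_smooth_on_const assms(2)]])
qed

section \<open>Closure properties of infinitely differentiable functions\<close>

lemma smooth_on_cong:
  "(\<And>x. x \<in> S \<Longrightarrow> f x = g x) \<Longrightarrow> smooth_on S f \<Longrightarrow> smooth_on S g"
  unfolding smooth_on_def by (rule allI, rule k_smooth_on_cong[of S f g]) simp_all

lemma smooth_on_subset: "smooth_on S f \<Longrightarrow> T \<subseteq> S \<Longrightarrow> smooth_on T f"
  unfolding smooth_on_def by (rule allI, rule k_smooth_on_subset[of _ S f]) simp_all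

lemma smooth_on_imp_continuous_on: "smooth_on S f \<Longrightarrow> continuous_on S f"
  unfolding smooth_on_def by (drule spec[of _ 0]) simp

lemma smooth_on_const: "smooth_on S (\<lambda>x. c)"
  by (simp add: smooth_on_def k_smooth_on_const)

lemma smooth_on_id: "smooth_on S (\<lambda>x. x)"
  by (simp add: smooth_on_def k_smooth_on_id)

lemma smooth_on_add: "smooth_on S f \<Longrightarrow> smooth_on S g \<Longrightarrow> smooth_on S (\<lambda>x. f x + g x)"
  by (simp add: smooth_on_def k_smooth_on_add)

lemma smooth_on_scaleR: "smooth_on S f \<Longrightarrow> smooth_on S g \<Longrightarrow> smooth_on S (\<lambda>x. f x *\<^sub>R g x)"
  by (simp add: smooth_on_def k_smooth_on_scaleR del: real_scaleR_def)

lemma smooth_on_mult: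
  fixes f g :: "'a::real_normed_vector \<Rightarrow> real"
  shows "smooth_on S f \<Longrightarrow> smooth_on S g \<Longrightarrow> smooth_on S (\<lambda>x. f x * g x)"
  using smooth_on_scaleR[of S f g] by simp

lemma smooth_on_minus:
  fixes f :: "'a::real_normed_vector \<Rightarrow> real"
  shows "smooth_on S f \<Longrightarrow> smooth_on S (\<lambda>x. - f x)"
  using smooth_on_mult[OF smooth_on_const[of S "-1"]] by simp

lemma smooth_on_diff:
  fixes f g :: "'a::real_normed_vector \<Rightarrow> real"
  shows "smooth_on S f \<Longrightarrow> smooth_on S g \<Longrightarrow> smooth_on S (\<lambda>x. f x - g x)"
  using smooth_on_add[OF _ smooth_on_minus, of S f g] by simp

lemma smooth_on_power:
  fixes f :: "'a::real_normed_vector \<Rightarrow> real"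
  shows "smooth_on S f \<Longrightarrow> smooth_on S (\<lambda>x. f x ^ n)"
  by (induction n) (simp_all add: smooth_on_const smooth_on_mult)

lemma smooth_on_compose:
  fixes f :: "'a::real_normed_vector \<Rightarrow> 'b::euclidean_space"
    and g :: "'b \<Rightarrow> 'c::real_normed_vector"
  shows "smooth_on T g \<Longrightarrow> smooth_on S f \<Longrightarrow> f ` S \<subseteq> T \<Longrightarrow> smooth_on S (\<lambda>x. g (f x))"
  unfolding smooth_on_def by (rule allI, rule k_smooth_on_compose[of _ T]) simp_all

lemma smooth_on_Un:
  "open S \<Longrightarrow> open T \<Longrightarrow> smooth_on S f \<Longrightarrow> smooth_on T f \<Longrightarrow> smooth_on (S \<union> T) f"
  unfolding smooth_on_def by (rule allI, rule k_smooth_on_Un) simp_all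

lemma smooth_on_antiderivative:
  fixes g :: "real \<Rightarrow> real"
  assumes "\<And>x. x \<in> S \<Longrightarrow> (g has_real_derivative g' x) (at x within S)" "smooth_on S g'"
  shows "smooth_on S g"
  unfolding smooth_on_def
proof
  fix k
  show "k_smooth_on k S g"
    using assms(2) k_smooth_on_SucD[OF k_smooth_on_antiderivative[OF assms(1)], of k]
    unfolding smooth_on_def by simp
qed

text \<open>The derivative is a multiple of a power with exponent \<open>a - 1\<close>, so the
  induction on the order runs over all exponents at once. Reciprocals, square roots and cube roots
  below are all written as \<open>powr\<close> in order to fall under this case.\<close>

lemma smooth_on_powr_pos: "smooth_on {0<..} (\<lambda>x::real. x powr a)"
  unfolding smooth_on_def
proof
  fix k
  show "k_smooth_on k {0<..} (\<lambda>x::real. x powr a)"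
  proof (induction k arbitrary: a)
    case 0
    then show ?case by (simp add: continuous_on_powr)
  next
    case (Suc k)
    show ?case
    proof (rule k_smooth_on_antiderivative)
      show "k_smooth_on k {0<..} (\<lambda>x::real. a * x powr (a - 1))"
        using k_smooth_on_scaleR[OF k_smooth_on_const Suc] by simp
      show "((\<lambda>x. x powr a) has_real_derivative a * x powr (a - 1)) (at x within {0<..})"
        if "x \<in> {0<..}" for x
        using that by (simp add: has_field_derivative_at_within has_real_derivative_powr)
    qed
  qed
qed

lemma smooth_on_powr:
  assumes "smooth_on S f" "\<And>x. x \<in> S \<Longrightarrow> f x > (0::real)"
  shows "smooth_on S (\<lambda>x. f x powr a)"
  by (rule smooth_on_compose[OF smooth_on_powr_pos assms(1)]) (simp add: assms(2) image_subset_iff)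

section \<open>The profile integral\<close>

definition integrand :: "real \<Rightarrow> real \<Rightarrow> real" where
  "integrand c b = 1 / sqrt (1/12 + c / b ^ 3)"

text \<open>For \<open>c < 0\<close> this is the positive zero of the radicand; the maximum sets it
  to 0 for \<open>c \<ge> 0\<close>, so that the range of integration is a single interval starting
  here in every case.\<close>

definition threshold :: "real \<Rightarrow> real" where
  "threshold c = root 3 (max 0 (-12 * c))"

lemma threshold_nonneg [simp]: "threshold c \<ge> 0"
  by (simp add: threshold_def)

lemma threshold_nonneg_eq [simp]: "c \<ge> 0 \<Longrightarrow> threshold c = 0"
  by (simp add: threshold_def)

lemma less_threshold_iff:
  assumes "b > 0"
  shows "threshold c < b \<longleftrightarrow> 1/12 + c / b ^ 3 > 0"
proof -
  have "threshold c < b \<longleftrightarrow> root 3 (max 0 (-12 * c)) < root 3 (b ^ 3)"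
    using assms by (simp add: threshold_def real_root_power_cancel)
  also have "\<dots> \<longleftrightarrow> max 0 (-12 * c) < b ^ 3" by simp
  also have "\<dots> \<longleftrightarrow> 1/12 + c / b ^ 3 > 0" using assms by (auto simp: field_simps)
  finally show ?thesis .
qed

lemma threshold_scale: "k \<ge> 0 \<Longrightarrow> threshold (k ^ 3 * c) = k * threshold c"
proof -
  assume "k \<ge> 0"
  then have "max 0 (-12 * (k ^ 3 * c)) = k ^ 3 * max 0 (-12 * c)"
    by (simp add: max_mult_distrib_left)
  with \<open>k \<ge> 0\<close> show ?thesis by (simp add: threshold_def real_root_mult real_root_power_cancel)
qed

text \<open>The integrand may blow up at the threshold, so the fundamental theorem is used in the
  form that asks for the derivative in the interior only and for continuity at the ends. Passing to
  the half-open range of integration changes the set by one point.\<close>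

lemma profile_integral_eqI:
  assumes cont: "continuous_on {threshold c..\<beta>} \<Phi>" and "threshold c \<le> \<beta>"
    and deriv: "\<And>b. threshold c < b \<Longrightarrow> b < \<beta> \<Longrightarrow> (\<Phi> has_real_derivative integrand c b) (at b)"
  shows "profile_integral c \<beta> = \<Phi> \<beta> - \<Phi> (threshold c)"
proof -
  let ?S = "{b. 0 < b \<and> b \<le> \<beta> \<and> 1/12 + c / b ^ 3 > 0}"
  have S: "?S = {threshold c<..\<beta>}"
  proof (rule set_eqI)
    show "b \<in> ?S \<longleftrightarrow> b \<in> {threshold c<..\<beta>}" for b
    proof (cases "b > 0")
      case True
      then show ?thesis using less_threshold_iff[OF True, of c] by auto
    next
      case False
      then have "\<not> threshold c < b" using threshold_nonneg[of c] by linarith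
      with False show ?thesis by simp
    qed
  qed
  have "(integrand c has_integral (\<Phi> \<beta> - \<Phi> (threshold c))) {threshold c..\<beta>}"
    by (rule fundamental_theorem_of_calculus_interior)
      (use assms in \<open>auto simp: has_real_derivative_iff_has_vector_derivative\<close>)
  also have "?this \<longleftrightarrow> (integrand c has_integral (\<Phi> \<beta> - \<Phi> (threshold c))) ?S"
    unfolding S
    by (rule has_integral_spike_set_eq)
      (auto intro: negligible_subset[of "{threshold c}"])
  finally show ?thesis
    unfolding profile_integral_def integrand_def[symmetric] by (rule integral_unique)
qed

lemma continuous_has_antiderivative:
  fixes g :: "real \<Rightarrow> real"
  assumes "continuous_on {a..} g"
  obtains G where "continuous_on {a..} G" "\<And>x. x > a \<Longrightarrow> (G has_real_derivative g x) (at x)"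
proof
  let ?G = "\<lambda>x. integral {a..x} g"
  have d: "(?G has_real_derivative g x) (at x within {a..x+1})" if "x \<ge> a" for x
    using that assms by (intro integral_has_real_derivative) (auto intro: continuous_on_subset)
  show "(?G has_real_derivative g x) (at x)" if "x > a" for x
    using d[of x] that at_within_interior[of x "{a..x+1}"] by simp
  have "continuous (at x within {a..}) ?G" if "x \<ge> a" for x
  proof -
    \<comment> \<open>Only points below \<open>x + 1\<close> matter near \<open>x\<close>, so the
      derivative on a bounded interval gives continuity on the whole ray.\<close>
    have "at x within {a..} = at x within ({a..} \<inter> {..<x+1})"
      by (rule at_within_nhd[of x "{..<x+1}"]) auto
    also have "\<dots> \<le> at x within {a..x+1}" by (rule at_le) auto
    finally show ?thesis
      using DERIV_continuous[OF d[OF that]] unfolding continuous_within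
      using at_le tendsto_mono by blast
  qed
  then show "continuous_on {a..} ?G" by (simp add: continuous_on_eq_continuous_within)
qed

text \<open>Continuity up to the threshold is what makes the improper integral converge. For
  \<open>c = 0\<close> the integrand is constant, for \<open>c > 0\<close> it extends continuously
  to 0, and for \<open>c < 0\<close> a change of variable is made.\<close>

lemma antiderivative_ex:
  obtains \<Phi> where "continuous_on {threshold c..} \<Phi>"
    "\<And>b. threshold c < b \<Longrightarrow> (\<Phi> has_real_derivative integrand c b) (at b)"
proof -
  consider "c = 0" | "c > 0" | "c < 0" by linarith
  then show thesis
  proof cases
    case 1
    show thesis
    proof (rule that)
      show "continuous_on {threshold c..} (\<lambda>b. sqrt 12 * b)" by (intro continuous_intros)
      show "((\<lambda>b. sqrt 12 * b) has_real_derivative integrand c b) (at b)" for b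
        using 1 by (auto intro!: derivative_eq_intros simp: integrand_def real_sqrt_divide)
    qed
  next
    case 2
    \<comment> \<open>Clearing \<open>b ^ 3\<close> gives the correct limit 0 at
      \<open>b = 0\<close>; \<open>integrand c 0\<close> itself equals \<open>sqrt 12\<close>,
      because division by zero yields 0.\<close>
    define g where "g b = sqrt (b ^ 3 / (b ^ 3 / 12 + c))" for b
    have pos: "b ^ 3 / 12 + c > 0" if "b \<ge> 0" for b using 2 that by (intro add_nonneg_pos) auto
    then have "b ^ 3 / 12 + c \<noteq> 0" if "b \<ge> 0" for b using that by (metis less_irrefl)
    then have "continuous_on {0..} g"
      unfolding g_def by (intro continuous_intros) auto
    then obtain G where "continuous_on {0..} G" "\<And>x. x > 0 \<Longrightarrow> (G has_real_derivative g x) (at x)"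
      by (rule continuous_has_antiderivative) (rule that)
    moreover have "g b = integrand c b" if "b > 0" for b
    proof -
      have "b ^ 3 / (b ^ 3 / 12 + c) = 1 / (1/12 + c / b ^ 3)"
        using that pos[of b] by (simp add: field_simps)
      then show ?thesis by (simp add: g_def integrand_def real_sqrt_divide)
    qed
    ultimately show thesis using 2 by (intro that) auto
  next
    case 3
    txt \<open>The substitution \<open>v = sqrt (b ^ 3 / 12 + c)\<close> removes the singularity at the threshold.\<close>
    define g where "g v = 8 * root 3 (12 * (v\<^sup>2 - c)) powr (- 1 / 2)" for v
    \<comment> \<open>Since \<open>c < 0\<close>, the base of the power stays positive even at
      \<open>v = 0\<close>, the image of the threshold.\<close>
    have "v\<^sup>2 - c > 0" for v using 3 zero_le_power2[of v] by linarith
    then have "continuous_on {0..} g"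
      unfolding g_def by (intro continuous_intros) (auto simp: less_le)
    then obtain G where G: "continuous_on {0..} G"
      "\<And>x. x > 0 \<Longrightarrow> (G has_real_derivative g x) (at x)"
      by (rule continuous_has_antiderivative) (rule that)
    let ?v = "\<lambda>b. sqrt (b ^ 3 / 12 + c)"
    show thesis
    proof (rule that)
      have "b ^ 3 / 12 + c \<ge> 0" if "threshold c \<le> b" for b
      proof -
        have "threshold c ^ 3 \<le> b ^ 3" using that by (intro power_mono) auto
        then show ?thesis using 3 by (simp add: threshold_def)
      qed
      then show "continuous_on {threshold c..} (\<lambda>b. G (?v b))"
        by (intro continuous_on_compose2[OF G(1)] continuous_intros) auto
      fix b assume b: "threshold c < b"
      then have b0: "b > 0" using threshold_nonneg[of c] by linarith
      have r: "1/12 + c / b ^ 3 > 0" using b less_threshold_iff[OF b0] by simp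
      then have pos: "b ^ 3 / 12 + c > 0" using b0 by (simp add: field_simps)
      have "12 * ((?v b)\<^sup>2 - c) = b ^ 3" using pos by simp
      then have g: "g (?v b) = 8 / sqrt b"
        using b0 by (simp add: g_def real_root_power_cancel powr_minus_divide powr_half_sqrt)
      \<comment> \<open>Here \<open>b\<^sup>2 / (8 * ?v b)\<close> is the derivative of the
        substitution. The product with \<open>8 / sqrt b\<close> is
        \<open>b * sqrt b / ?v b\<close>, which is the integrand.\<close>
      have "((\<lambda>b. G (?v b)) has_real_derivative g (?v b) * (b\<^sup>2 / (8 * ?v b))) (at b)"
        using pos by (intro DERIV_chain2[OF G(2)])
          (auto intro!: derivative_eq_intros simp: divide_simps)
      moreover have "g (?v b) * (b\<^sup>2 / (8 * ?v b)) = integrand c b"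
      proof -
        have "?v b = b * sqrt b * sqrt (1/12 + c / b ^ 3)"
        proof -
          have "b ^ 3 / 12 + c = b\<^sup>2 * b * (1/12 + c / b ^ 3)"
            using b0 by (simp add: field_simps power2_eq_square power3_eq_cube)
          then show ?thesis using b0 by (simp only: real_sqrt_mult) simp
        qed
        then show ?thesis unfolding g integrand_def
          using b0 r by (simp add: field_simps power2_eq_square)
      qed
      ultimately show "((\<lambda>b. G (?v b)) has_real_derivative integrand c b) (at b)" by simp
    qed
  qed
qed

lemma profile_integral_antiderivative:
  shows continuous_on_profile_integral: "continuous_on {threshold c..} (profile_integral c)" (is ?A)
    and has_real_derivative_profile_integral:
      "threshold c < b \<Longrightarrow> (profile_integral c has_real_derivative integrand c b) (at b)"
    and profile_integral_threshold: "profile_integral c (threshold c) = 0"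
proof -
  obtain \<Phi> where \<Phi>: "continuous_on {threshold c..} \<Phi>"
    "\<And>b. threshold c < b \<Longrightarrow> (\<Phi> has_real_derivative integrand c b) (at b)"
    by (rule antiderivative_ex) (rule that)
  have eq: "profile_integral c \<beta> = \<Phi> \<beta> - \<Phi> (threshold c)" if "threshold c \<le> \<beta>" for \<beta>
    by (rule profile_integral_eqI) (use that \<Phi> in \<open>auto intro: continuous_on_subset\<close>)
  have "continuous_on {threshold c..} (\<lambda>\<beta>. \<Phi> \<beta> - \<Phi> (threshold c))"
    by (intro continuous_intros \<Phi>)
  then show ?A by (rule continuous_on_eq) (simp add: eq)
  show "(profile_integral c has_real_derivative integrand c b) (at b)" if "threshold c < b"
  proof (rule has_field_derivative_transform_within_open)
    show "((\<lambda>\<beta>. \<Phi> \<beta> - \<Phi> (threshold c)) has_real_derivative integrand c b) (at b)"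
      using that by (auto intro!: derivative_eq_intros \<Phi>)
    show "\<Phi> \<beta> - \<Phi> (threshold c) = profile_integral c \<beta>" if "\<beta> \<in> {threshold c<..}" for \<beta>
      using eq that by simp
  qed (use that in auto)
  show "profile_integral c (threshold c) = 0" using eq[of "threshold c"] by simp
qed

text \<open>The quotient \<open>c / b ^ 3\<close> is invariant under replacing \<open>(c, b)\<close>
  by \<open>(k ^ 3 * c, k * b)\<close>. So the right-hand side, as a function of \<open>b\<close>,
  is an antiderivative of \<open>integrand (k ^ 3 * c)\<close>, and it vanishes at the
  threshold.\<close>

lemma profile_integral_scale:
  assumes "k > 0" "threshold c < b / k"
  shows "profile_integral (k ^ 3 * c) b = k * profile_integral c (b / k)"
proof -
  define c' where "c' = k ^ 3 * c"
  let ?\<Phi> = "\<lambda>b. k * profile_integral c (b / k)"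
  have t: "threshold c' = k * threshold c" using assms(1) by (simp add: threshold_scale c'_def)
  have "profile_integral c' b = ?\<Phi> b - ?\<Phi> (threshold c')"
  proof (rule profile_integral_eqI)
    show "continuous_on {threshold c'..b} ?\<Phi>"
      using assms(1)
      by (intro continuous_intros continuous_on_compose2[OF continuous_on_profile_integral])
        (auto simp: t field_simps)
    show "threshold c' \<le> b" using assms by (simp add: t field_simps)
    fix x assume "threshold c' < x"
    then have x: "threshold c < x / k" using assms(1) by (simp add: t field_simps)
    have "integrand c (x / k) = integrand c' x"
      using assms(1) by (simp add: integrand_def c'_def field_simps)
    then show "(?\<Phi> has_real_derivative integrand c' x) (at x)"
      using assms(1) DERIV_cmult[OF DERIV_chain2[OF has_real_derivative_profile_integral[OF x]
            DERIV_cdivide[OF DERIV_ident]], of k]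
      by simp
  qed
  then show ?thesis using assms(1) by (simp add: t profile_integral_threshold flip: c'_def)
qed

lemma profile_integral_zero: "b \<ge> 0 \<Longrightarrow> profile_integral 0 b = sqrt 12 * b"
  using profile_integral_eqI[of 0 b "\<lambda>b. sqrt 12 * b"]
  by (auto intro!: continuous_intros derivative_eq_intros simp: integrand_def real_sqrt_divide)

text \<open>By l'Hospital's rule, the limit is that of the integrand, where \<open>c / s ^ 3\<close>
  disappears.\<close>

lemma profile_integral_asymp: "((\<lambda>s. profile_integral c s / s) \<longlongrightarrow> sqrt 12) at_top"
proof (rule lhospital_at_top_at_top)
  show "filterlim (\<lambda>x::real. x) at_top at_top" by (rule filterlim_ident)
  show "\<forall>\<^sub>F s in at_top. (profile_integral c has_real_derivative integrand c s) (at s)"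
    using eventually_gt_at_top[of "threshold c"]
    by eventually_elim (rule has_real_derivative_profile_integral)
  have "((\<lambda>s. 1 / sqrt (1/12 + c * inverse s ^ 3)) \<longlongrightarrow> 1 / sqrt (1/12 + c * 0 ^ 3)) at_top"
    by (intro tendsto_intros tendsto_inverse_0_at_top filterlim_ident) simp_all
  then show "((\<lambda>s. integrand c s / 1) \<longlongrightarrow> sqrt 12) at_top"
    by (simp add: integrand_def[abs_def] field_simps real_sqrt_divide)
qed (auto intro: always_eventually)

lemma smooth_on_profile_integral: "smooth_on {threshold c<..} (profile_integral c)"
proof (rule smooth_on_antiderivative)
  show "(profile_integral c has_real_derivative integrand c b) (at b within {threshold c<..})"
    if "b \<in> {threshold c<..}" for b
    using has_real_derivative_profile_integral that by (auto intro: has_field_derivative_at_within)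
  have pos: "0 < b" "1/12 + c * b powr (-3) > 0" if "b \<in> {threshold c<..}" for b
  proof -
    show b: "0 < b" using that threshold_nonneg[of c] by (simp del: threshold_nonneg)
    then show "1/12 + c * b powr (-3) > 0"
      using that less_threshold_iff[OF b] by (simp add: powr_minus_divide powr_numeral)
  qed
  have "smooth_on {threshold c<..} (\<lambda>b. (1/12 + c * b powr (-3)) powr (-1/2))"
    using pos by (intro smooth_on_powr smooth_on_add smooth_on_mult smooth_on_const smooth_on_id) auto
  then show "smooth_on {threshold c<..} (integrand c)"
  proof (rule smooth_on_cong[rotated])
    fix b assume b: "b \<in> {threshold c<..}"
    show "(1/12 + c * b powr (-3)) powr (-1/2) = integrand c b"
      using pos[OF b] by (simp add: integrand_def powr_minus_divide powr_numeral powr_half_sqrt)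
  qed
qed

text \<open>This makes the limit uniform in \<open>c\<close>. Scaling by
  \<open>k = root 3 \<bar>c\<bar>\<close> turns \<open>profile_integral c b / b\<close> into the
  quotient of the asymptotics at \<open>sgn c\<close> and \<open>s = b / k\<close>, and smallness of
  \<open>c\<close> relative to \<open>b ^ 3\<close> means that \<open>s\<close> is large.\<close>

lemma profile_integral_near_zero:
  assumes "\<epsilon> > 0"
  obtains \<delta> where "\<delta> > 0"
    "\<And>c b. b > 0 \<Longrightarrow> \<bar>c\<bar> < \<delta> * b ^ 3 \<Longrightarrow> \<bar>profile_integral c b - sqrt 12 * b\<bar> \<le> \<epsilon> * b"
proof -
  have "\<exists>S. \<forall>s\<ge>S. \<bar>profile_integral c s / s - sqrt 12\<bar> < \<epsilon>" for c
    using tendstoD[OF profile_integral_asymp[of c] assms]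
    by (simp add: eventually_at_top_linorder dist_real_def)
  then obtain S where S: "\<And>c s. s \<ge> S c \<Longrightarrow> \<bar>profile_integral c s / s - sqrt 12\<bar> < \<epsilon>"
    by metis
  \<comment> \<open>Only the parameters 1 and -1 occur after scaling. The entry 1 keeps
    \<open>M\<close> positive, and the last entry puts \<open>b / k\<close> strictly above the
    threshold, as scaling requires.\<close>
  define M where "M = Max {1, S 1, S (-1), threshold (-1) + 1}"
  have M: "M \<ge> 1" "M \<ge> S 1" "M \<ge> S (-1)" "M \<ge> threshold (-1) + 1" by (auto simp: M_def)
  show thesis
  proof (rule that)
    show "1 / M ^ 3 > 0" using M by simp
    fix c b :: real
    assume b: "b > 0" and c: "\<bar>c\<bar> < 1 / M ^ 3 * b ^ 3"
    show "\<bar>profile_integral c b - sqrt 12 * b\<bar> \<le> \<epsilon> * b"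
    proof (cases "c = 0")
      case True
      then show ?thesis using b assms by (simp add: profile_integral_zero)
    next
      case False
      define k where "k = root 3 \<bar>c\<bar>"
      have k: "k > 0" "k ^ 3 = \<bar>c\<bar>" using False by (simp_all add: k_def)
      have "(M * k) ^ 3 < b ^ 3" using c M(1) by (simp add: k power_mult_distrib field_simps)
      then have "M * k < b" using b by (simp add: power_less_imp_less_base)
      then have s: "M < b / k" using k by (simp add: field_simps)
      have sgn: "sgn c = 1 \<or> sgn c = -1" using False by (auto simp: sgn_if)
      then have t: "threshold (sgn c) < b / k" "S (sgn c) \<le> b / k" using s M by auto
      have "c = k ^ 3 * sgn c" by (simp add: k sgn_if)
      then have "profile_integral c b = k * profile_integral (sgn c) (b / k)"
        using profile_integral_scale[OF k(1) t(1)] by simp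
      then have "profile_integral c b - sqrt 12 * b
          = b * (profile_integral (sgn c) (b / k) / (b / k) - sqrt 12)"
        using k b by (simp add: field_simps)
      then have "\<bar>profile_integral c b - sqrt 12 * b\<bar>
          = b * \<bar>profile_integral (sgn c) (b / k) / (b / k) - sqrt 12\<bar>"
        using b by (simp only: abs_mult abs_of_pos)
      also have "\<dots> \<le> b * \<epsilon>" using S[OF t(2)] b by (intro mult_left_mono) auto
      finally show ?thesis by (simp add: mult.commute)
    qed
  qed
qed

text \<open>Here \<open>c\<close> is the constant sign of \<open>f\<close> on \<open>S\<close>.
  Scaling by the cube root of the absolute value of \<open>f y\<close>, which is smooth because
  \<open>f\<close> has no zero on \<open>S\<close>, moves all dependence on \<open>y\<close> out of
  the parameter and leaves the smooth one-variable function
  \<open>profile_integral c\<close>.\<close>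

lemma smooth_on_profile_integral_compose:
  assumes f: "smooth_on S f" and b: "smooth_on S b"
    and pos: "\<And>y. y \<in> S \<Longrightarrow> b y > 0" "\<And>y. y \<in> S \<Longrightarrow> threshold (f y) < b y"
    and c: "c\<^sup>2 = 1" "\<And>y. y \<in> S \<Longrightarrow> c * f y > 0"
  shows "smooth_on S (\<lambda>y. profile_integral (f y) (b y))"
proof -
  define k where "k y = (c * f y) powr (1/3)" for y
  have k: "k y > 0" "k y ^ 3 * c = f y" if "y \<in> S" for y
  proof -
    show "k y > 0" using c(2)[OF that] by (auto simp: k_def)
    have "k y ^ 3 = c * f y"
      using c(2)[OF that] by (simp add: k_def powr_powr flip: powr_numeral)
    then show "k y ^ 3 * c = f y" using c(1) by (simp add: power2_eq_square mult.commute mult.left_commute)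
  qed
  have lt: "threshold c < b y / k y" if "y \<in> S" for y
  proof -
    have "k y * threshold c < b y"
      using pos(2)[OF that] threshold_scale[of "k y" c] k[OF that] by simp
    then show ?thesis using k(1)[OF that] by (simp add: field_simps)
  qed
  have "smooth_on S (\<lambda>y. k y * profile_integral c (b y * (c * f y) powr (-1/3)))"
    unfolding k_def
  proof (intro smooth_on_mult smooth_on_powr smooth_on_const f c)
    show "smooth_on S (\<lambda>y. profile_integral c (b y * (c * f y) powr (-1/3)))"
    proof (rule smooth_on_compose[OF smooth_on_profile_integral])
      show "smooth_on S (\<lambda>y. b y * (c * f y) powr (-1/3))"
        by (intro smooth_on_mult smooth_on_powr smooth_on_const f b c)
      show "(\<lambda>y. b y * (c * f y) powr (-1/3)) ` S \<subseteq> {threshold c<..}"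
        using lt by (auto simp: k_def powr_minus_divide)
    qed
  qed
  then show ?thesis
  proof (rule smooth_on_cong[rotated])
    fix y assume y: "y \<in> S"
    show "k y * profile_integral c (b y * (c * f y) powr (-1/3)) = profile_integral (f y) (b y)"
      using profile_integral_scale[OF k(1)[OF y] lt[OF y]] k(2)[OF y]
      by (simp add: k_def powr_minus_divide)
  qed
qed

section \<open>Regularity in \<open>y\<close> of the profile integral along smooth data\<close>

context
  fixes f b :: "real \<Rightarrow> real"
  assumes f: "smooth_on UNIV f" and b: "smooth_on UNIV b"
    and pos: "\<And>y. b y > 0" "\<And>y. threshold (f y) < b y"
begin

lemma open_nonzero: "open {y. f y > 0}" "open {y. f y < 0}"
  using smooth_on_imp_continuous_on[OF f] by (auto intro: open_Collect_less continuous_on_const)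

lemma smooth_on_profile_integral_nonzero:
  "smooth_on ({y. f y > 0} \<union> {y. f y < 0}) (\<lambda>y. profile_integral (f y) (b y))"
proof (rule smooth_on_Un[OF open_nonzero])
  show "smooth_on {y. f y > 0} (\<lambda>y. profile_integral (f y) (b y))"
    by (rule smooth_on_profile_integral_compose[where c = 1])
      (simp_all add: smooth_on_subset[OF f] smooth_on_subset[OF b] pos)
  show "smooth_on {y. f y < 0} (\<lambda>y. profile_integral (f y) (b y))"
    by (rule smooth_on_profile_integral_compose[where c = "-1"])
      (simp_all add: smooth_on_subset[OF f] smooth_on_subset[OF b] pos)
qed

text \<open>The zero set is closed, so the complement of its frontier is the union of three open
  sets: its interior, where the integral is \<open>sqrt 12 * b y\<close>, and the two sets where
  \<open>f\<close> has a strict sign.\<close>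

lemma smooth_on_profile_integral_frontier:
  "smooth_on (- frontier {y. f y = 0}) (\<lambda>y. profile_integral (f y) (b y))"
proof -
  let ?Z = "{y. f y = 0}"
  have "closed ?Z"
    using smooth_on_imp_continuous_on[OF f] by (intro closed_Collect_eq continuous_on_const)
  then have "- frontier ?Z = interior ?Z \<union> ({y. f y > 0} \<union> {y. f y < 0})"
    using interior_subset[of ?Z] by (auto simp: frontier_def)
  moreover have "smooth_on (interior ?Z) (\<lambda>y. profile_integral (f y) (b y))"
  proof (rule smooth_on_cong)
    show "smooth_on (interior ?Z) (\<lambda>y. sqrt 12 * b y)"
      by (intro smooth_on_mult smooth_on_const smooth_on_subset[OF b]) simp
    show "sqrt 12 * b y = profile_integral (f y) (b y)" if "y \<in> interior ?Z" for y
      using that interior_subset[of ?Z] pos(1)[of y] by (auto simp: profile_integral_zero)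
  qed
  ultimately show ?thesis
    using smooth_on_Un[OF open_interior _ _ smooth_on_profile_integral_nonzero] open_nonzero
    by (simp add: open_Un)
qed

text \<open>Only zeros of \<open>f\<close> need an argument beyond smoothness. There the integral is
  compared with the continuous function \<open>sqrt 12 * b z\<close>, and the error tends to
  0.\<close>

lemma continuous_on_profile_integral_compose:
  "continuous_on UNIV (\<lambda>y. profile_integral (f y) (b y))"
proof -
  have "isCont (\<lambda>y. profile_integral (f y) (b y)) y" for y
  proof (cases "f y = 0")
    case False
    then have "y \<in> {y. f y > 0} \<union> {y. f y < 0}" by auto
    then show ?thesis
      using smooth_on_imp_continuous_on[OF smooth_on_profile_integral_nonzero] open_nonzero
      by (metis continuous_on_eq_continuous_at open_Un)
  next
    case True
    have "f \<midarrow>y\<rightarrow> f y" and "b \<midarrow>y\<rightarrow> b y"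
      using smooth_on_imp_continuous_on[OF f] smooth_on_imp_continuous_on[OF b]
      by (simp_all add: continuous_on_eq_continuous_at isCont_def)
    with True have lim: "f \<midarrow>y\<rightarrow> 0" "b \<midarrow>y\<rightarrow> b y" by simp_all
    have "(\<lambda>z. profile_integral (f z) (b z) - sqrt 12 * b z) \<midarrow>y\<rightarrow> 0"
    proof (rule tendstoI)
      fix e :: real assume e: "e > 0"
      \<comment> \<open>Near \<open>y\<close> one has \<open>b z < 2 * b y\<close>, so a relative
        error \<open>\<epsilon>\<close> costs less than \<open>e\<close>.\<close>
      define \<epsilon> where "\<epsilon> = e / (2 * b y)"
      have "\<epsilon> > 0" using e pos(1)[of y] by (simp add: \<epsilon>_def)
      then obtain \<delta> where \<delta>: "\<delta> > 0"
        "\<And>c b. b > 0 \<Longrightarrow> \<bar>c\<bar> < \<delta> * b ^ 3 \<Longrightarrow> \<bar>profile_integral c b - sqrt 12 * b\<bar> \<le> \<epsilon> * b"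
        by (rule profile_integral_near_zero) (rule that)
      have "(\<lambda>z. \<delta> * b z ^ 3 - \<bar>f z\<bar>) \<midarrow>y\<rightarrow> \<delta> * b y ^ 3 - \<bar>0\<bar>"
        by (intro tendsto_intros lim)
      then have "\<forall>\<^sub>F z in at y. 0 < \<delta> * b z ^ 3 - \<bar>f z\<bar>"
        by (rule order_tendstoD) (simp add: \<delta> pos)
      moreover have "\<forall>\<^sub>F z in at y. b z < 2 * b y"
        using lim(2) by (rule order_tendstoD) (simp add: pos)
      ultimately show "\<forall>\<^sub>F z in at y. dist (profile_integral (f z) (b z) - sqrt 12 * b z) 0 < e"
      proof eventually_elim
        case (elim z)
        then have "\<bar>profile_integral (f z) (b z) - sqrt 12 * b z\<bar> \<le> \<epsilon> * b z"
          using pos(1) by (intro \<delta>) auto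
        also have "\<dots> < \<epsilon> * (2 * b y)" using elim \<open>\<epsilon> > 0\<close> by simp
        also have "\<dots> = e" using pos(1)[of y] by (simp add: \<epsilon>_def)
        finally show ?case by (simp add: dist_real_def)
      qed
    qed
    from tendsto_add[OF this tendsto_mult[OF tendsto_const lim(2)], of "sqrt 12"]
    show ?thesis using True pos(1)[of y] by (simp add: isCont_def profile_integral_zero)
  qed
  then show ?thesis by (simp add: continuous_on_eq_continuous_at)
qed

end

section \<open>Derivatives along the lines of constant \<open>y\<close>\<close>

definition char_line :: "real \<Rightarrow> real set" where
  "char_line y = {x. tr_of_xy x y \<in> tr_domain}"

lemma char_line_eq: "char_line y = {y..} \<inter> {2 - y<..}"
  by (auto simp: char_line_def tr_of_xy_def tr_domain_def)

lemma convex_char_line: "convex (char_line y)"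
  unfolding char_line_eq by (intro convex_Int) auto

text \<open>The line is a ray unbounded to the right, so points to the right of \<open>x\<close>
  always remain, even at a boundary point. This gives uniqueness of the possibly one-sided
  derivatives.\<close>

lemma at_char_line_neq_bot: "x \<in> char_line y \<Longrightarrow> at x within char_line y \<noteq> bot"
proof -
  assume x: "x \<in> char_line y"
  then have "{x..x+1} \<subseteq> char_line y" by (auto simp: char_line_eq)
  moreover have "x islimpt {x..x+1}" by (simp add: islimpt_Icc)
  ultimately show ?thesis by (metis islimpt_subset trivial_limit_within)
qed

lemma ball_tr_domain:
  "(\<forall>p\<in>tr_domain. P p) \<longleftrightarrow> (\<forall>y. \<forall>x\<in>char_line y. P (tr_of_xy x y))"
proof (intro iffI ballI allI)
  fix p assume *: "\<forall>y. \<forall>x\<in>char_line y. P (tr_of_xy x y)" and p: "p \<in> tr_domain"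
  obtain t r where tr: "p = (t, r)" by (cases p)
  have "tr_of_xy (t + r) (r - t) = p" by (simp add: tr tr_of_xy_def)
  then show "P p" using * p unfolding char_line_def by (metis mem_Collect_eq)
qed (auto simp: char_line_def)

lemma x_deriv_tr_of_xy:
  "x_deriv F (tr_of_xy x y) = vector_derivative (\<lambda>x. F (tr_of_xy x y)) (at x within char_line y)"
proof -
  have "(x - y) / 2 + (x + y) / 2 = x" "(x + y) / 2 - (x - y) / 2 = y" by argo+
  then show ?thesis by (simp add: x_deriv_def tr_of_xy_def char_line_def)
qed

lemma x_deriv_eqI:
  assumes "x \<in> char_line y"
    and "((\<lambda>x. F (tr_of_xy x y)) has_real_derivative D) (at x within char_line y)"
  shows "x_deriv F (tr_of_xy x y) = D"
  using assms(2) unfolding x_deriv_tr_of_xy has_real_derivative_iff_has_vector_derivative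
  by (rule vector_derivative_within[OF at_char_line_neq_bot[OF assms(1)]])

text \<open>With \<open>y\<close> fixed, \<open>tr_of_xy\<close> moves with constant velocity
  \<open>(1/2, 1/2)\<close>, so the derivative in \<open>x\<close> is a directional derivative in
  \<open>(t, r)\<close>.\<close>

lemma x_deriv_directional:
  assumes F: "\<And>p. p \<in> tr_domain \<Longrightarrow> (F has_derivative F' p) (at p within tr_domain)"
    and x: "x \<in> char_line y"
  shows "((\<lambda>x. F (tr_of_xy x y)) has_real_derivative F' (tr_of_xy x y) (1/2, 1/2)) (at x within char_line y)"
proof -
  let ?L = "F' (tr_of_xy x y)"
  have p: "tr_of_xy x y \<in> tr_domain" using x by (simp add: char_line_def)
  have "((\<lambda>x. tr_of_xy x y) has_derivative (\<lambda>v. v *\<^sub>R (1/2, 1/2))) (at x within char_line y)"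
    unfolding tr_of_xy_def by (auto intro!: derivative_eq_intros simp: fun_eq_iff)
  from has_derivative_in_compose2[OF F _ x this]
  have "((\<lambda>x. F (tr_of_xy x y)) has_derivative (\<lambda>v. ?L (v *\<^sub>R (1/2, 1/2)))) (at x within char_line y)"
    by (auto simp: char_line_def)
  moreover have "(\<lambda>v. ?L (v *\<^sub>R (1/2, 1/2))) = (*) (?L (1/2, 1/2))"
    by (rule ext) (simp only: linear_scale[OF has_derivative_linear[OF F[OF p]]] real_scaleR_def mult.commute)
  ultimately show ?thesis by (simp only: has_field_derivative_def)
qed

lemma has_real_derivative_x_deriv:
  assumes "smooth_on tr_domain F" "x \<in> char_line y"
  shows "((\<lambda>x. F (tr_of_xy x y)) has_real_derivative x_deriv F (tr_of_xy x y)) (at x within char_line y)"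
proof -
  obtain F' where F: "\<And>p. p \<in> tr_domain \<Longrightarrow> (F has_derivative F' p) (at p within tr_domain)"
    using assms(1) unfolding smooth_on_def by (metis k_smooth_on.simps(2))
  show ?thesis
    using x_deriv_directional[OF F assms(2)] x_deriv_eqI[OF assms(2)] by simp
qed

text \<open>The direction \<open>(1/2, 1/2)\<close> is fixed, and the definition of order
  \<open>Suc k\<close> provides order \<open>k\<close> for the derivative in each fixed
  direction.\<close>

lemma smooth_on_x_deriv:
  assumes "smooth_on tr_domain F"
  shows "smooth_on tr_domain (x_deriv F)"
  unfolding smooth_on_def
proof
  fix k
  have "k_smooth_on (Suc k) tr_domain F" using assms unfolding smooth_on_def by blast
  then obtain F' where F: "\<And>p. p \<in> tr_domain \<Longrightarrow> (F has_derivative F' p) (at p within tr_domain)"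
    "\<And>v. k_smooth_on k tr_domain (\<lambda>p. F' p v)"
    by (rule k_smooth_on_SucE) (rule that)
  have "\<forall>p\<in>tr_domain. F' p (1/2, 1/2) = x_deriv F p"
    unfolding ball_tr_domain using x_deriv_eqI[OF _ x_deriv_directional[OF F(1)]] by simp
  then show "k_smooth_on k tr_domain (x_deriv F)"
    by (intro k_smooth_on_cong[OF _ F(2)[of "(1/2, 1/2)"]]) simp
qed

lemma has_real_derivative_profile_integral_line:
  assumes "smooth_on tr_domain B" "x \<in> char_line y" "threshold c < B (tr_of_xy x y)"
  shows "((\<lambda>x. profile_integral c (B (tr_of_xy x y))) has_real_derivative
    integrand c (B (tr_of_xy x y)) * x_deriv B (tr_of_xy x y)) (at x within char_line y)"
  by (rule DERIV_chain2[where f = "profile_integral c" and g = "\<lambda>x. B (tr_of_xy x y)"])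
    (intro has_real_derivative_profile_integral has_real_derivative_x_deriv assms)+

lemma constant_on_char_line:
  assumes "\<And>x. x \<in> char_line y \<Longrightarrow> (g has_real_derivative 0) (at x within char_line y)"
    and "x \<in> char_line y" "x' \<in> char_line y"
  shows "g x = g x'"
proof -
  have "\<exists>c. \<forall>x\<in>char_line y. g x = c"
    by (rule has_field_derivative_zero_constant[OF convex_char_line assms(1)])
  then show ?thesis using assms(2,3) by auto
qed

section \<open>The system and the explicit expressions on lines of constant \<open>y\<close>, and
  the two implications\<close>

lemma solves_system_iff:
  "solves_system A B \<longleftrightarrow> (\<forall>y. \<forall>x\<in>char_line y.
     A (tr_of_xy x y) = 2 * B (tr_of_xy x y) * x_deriv B (tr_of_xy x y) \<and>
     8 * B (tr_of_xy x y) * x_deriv (x_deriv B) (tr_of_xy x y) + 12 * (x_deriv B (tr_of_xy x y))\<^sup>2 = 1)"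
  unfolding solves_system_def ball_tr_domain ..

lemma given_by_iff:
  "given_by f h A B \<longleftrightarrow> (\<forall>y. \<forall>x\<in>char_line y.
     A (tr_of_xy x y) = 2 * B (tr_of_xy x y) * sqrt (1/12 + f y / B (tr_of_xy x y) ^ 3) \<and>
     x = profile_integral (f y) (B (tr_of_xy x y)) + h y)"
proof -
  have "(x - y) / 2 + (x + y) / 2 = x" "(x + y) / 2 - (x - y) / 2 = y" for x y :: real by argo+
  then show ?thesis unfolding given_by_def ball_tr_domain by (simp add: tr_of_xy_def)
qed

text \<open>Differentiating the integral identity along a line, where \<open>f y\<close> and
  \<open>h y\<close> are constants, gives \<open>B\<^sub>x\<close> as the square root of the
  radicand. Differentiating once more gives the second equation.\<close>

lemma given_by_imp_solves_system:
  assumes B: "smooth_on tr_domain B"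
    and Apos: "\<And>p. p \<in> tr_domain \<Longrightarrow> A p > 0" and Bpos: "\<And>p. p \<in> tr_domain \<Longrightarrow> B p > 0"
    and given: "given_by f h A B"
  shows "solves_system A B"
  unfolding solves_system_iff
proof (intro allI ballI)
  fix y x assume x: "x \<in> char_line y"
  let ?b = "\<lambda>x. B (tr_of_xy x y)"
  let ?R = "\<lambda>x. 1/12 + f y / ?b x ^ 3"
  have pos: "?b x > 0" "?R x > 0" if "x \<in> char_line y" for x
  proof -
    have p: "tr_of_xy x y \<in> tr_domain" using that by (simp add: char_line_def)
    show "?b x > 0" by (rule Bpos[OF p])
    \<comment> \<open>Positivity of \<open>A\<close> forces a positive radicand, since
      \<open>sqrt\<close> of a nonpositive number is nonpositive.\<close>
    moreover have "2 * ?b x * sqrt (?R x) > 0"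
      using given that Apos[OF p] unfolding given_by_iff by simp
    ultimately show "?R x > 0" by (simp add: zero_less_mult_iff)
  qed
  have Bx: "x_deriv B (tr_of_xy x y) = sqrt (?R x)" if x: "x \<in> char_line y" for x
  proof -
    have t: "threshold (f y) < ?b x" using pos[OF x] by (simp add: less_threshold_iff)
    have "((\<lambda>x. profile_integral (f y) (?b x) + h y) has_real_derivative
        integrand (f y) (?b x) * x_deriv B (tr_of_xy x y)) (at x within char_line y)"
      using DERIV_add[OF has_real_derivative_profile_integral_line[OF B x t] DERIV_const, of "h y"]
      by simp
    then have "((\<lambda>x. x) has_real_derivative
        integrand (f y) (?b x) * x_deriv B (tr_of_xy x y)) (at x within char_line y)"
    proof (rule has_field_derivative_transform_within[OF _ zero_less_one x])
      show "profile_integral (f y) (?b x) + h y = x" if "x \<in> char_line y" for x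
        using given that unfolding given_by_iff by simp
    qed
    then have "integrand (f y) (?b x) * x_deriv B (tr_of_xy x y) = 1"
      unfolding has_real_derivative_iff_has_vector_derivative
      by (rule vector_derivative_unique_within[OF at_char_line_neq_bot[OF x] _ has_vector_derivative_id])
    then show ?thesis using pos[OF x] by (simp add: integrand_def field_simps)
  qed
  have d: "(?b has_real_derivative sqrt (?R x)) (at x within char_line y)"
    using has_real_derivative_x_deriv[OF B x] Bx[OF x] by simp
  \<comment> \<open>The factor \<open>sqrt (?R x)\<close> from the derivative of \<open>?b\<close>
    cancels the one in the denominator of the derivative of the root.\<close>
  have "((\<lambda>x. sqrt (?R x)) has_real_derivative - 3 * f y / (2 * ?b x ^ 4)) (at x within char_line y)"
    using pos[OF x]
    by (auto intro!: derivative_eq_intros d simp: field_simps power_numeral_reduce)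
  then have "((\<lambda>x. x_deriv B (tr_of_xy x y)) has_real_derivative - 3 * f y / (2 * ?b x ^ 4)) (at x within char_line y)"
    by (rule has_field_derivative_transform_within[OF _ zero_less_one x]) (simp add: Bx)
  then have "x_deriv (x_deriv B) (tr_of_xy x y) = - 3 * f y / (2 * ?b x ^ 4)"
    by (rule x_deriv_eqI[OF x])
  moreover have "8 * ?b x * (- 3 * f y / (2 * ?b x ^ 4)) + 12 * ?R x = 1"
    using pos(1)[OF x] by (simp add: field_simps power_numeral_reduce)
  ultimately show "A (tr_of_xy x y) = 2 * ?b x * x_deriv B (tr_of_xy x y) \<and>
      8 * ?b x * x_deriv (x_deriv B) (tr_of_xy x y) + 12 * (x_deriv B (tr_of_xy x y))\<^sup>2 = 1"
    using Bx[OF x] pos[OF x] given x unfolding given_by_iff by simp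
qed

text \<open>Both functions are read off at one point of each line: \<open>f\<close> as the value of
  the conserved quantity \<open>E\<close>, and \<open>h\<close> as the value of the difference
  between \<open>x\<close> and the profile integral, which is constant along the line.\<close>

lemma solves_system_imp_given_by:
  assumes B: "smooth_on tr_domain B"
    and Apos: "\<And>p. p \<in> tr_domain \<Longrightarrow> A p > 0" and Bpos: "\<And>p. p \<in> tr_domain \<Longrightarrow> B p > 0"
    and solves: "solves_system A B"
  shows "\<exists>f h. admissible_data f h \<and> given_by f h A B"
proof -
  txt \<open>The curve \<open>x = y\<^sup>2 + 3\<close> meets every line of constant \<open>y\<close> inside the domain, so that functions
    constant along these lines become smooth functions of \<open>y\<close>.\<close>
  define X where "X y = y\<^sup>2 + 3" for y :: real
  have X: "X y \<in> char_line y" for y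
  proof -
    \<comment> \<open>Completing the square yields \<open>X y > y\<close> and
      \<open>X y > 2 - y\<close>, the two conditions for lying on the line.\<close>
    have "0 \<le> (y - 1/2)\<^sup>2" "0 \<le> (y + 1/2)\<^sup>2" by simp_all
    then show ?thesis unfolding X_def char_line_eq by (simp add: power2_eq_square algebra_simps)
  qed
  define \<gamma> where "\<gamma> y = tr_of_xy (X y) y" for y
  have \<gamma>: "\<gamma> ` UNIV \<subseteq> tr_domain" using X by (auto simp: \<gamma>_def char_line_def)
  have X_smooth: "smooth_on UNIV X"
    unfolding X_def by (intro smooth_on_add smooth_on_power smooth_on_const smooth_on_id)
  have "\<gamma> = (\<lambda>y. X y *\<^sub>R (1/2, 1/2) + y *\<^sub>R (-1/2, 1/2))"
    by (auto simp: \<gamma>_def tr_of_xy_def fun_eq_iff field_simps)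
  then have \<gamma>_smooth: "smooth_on UNIV \<gamma>"
    by (simp only:) (intro smooth_on_add smooth_on_scaleR smooth_on_const smooth_on_id X_smooth)
  define E where "E p = B p ^ 3 * ((x_deriv B p)\<^sup>2 - 1/12)" for p
  define f where "f y = E (\<gamma> y)" for y
  define b where "b y = B (\<gamma> y)" for y
  define h where "h y = X y - profile_integral (f y) (b y)" for y
  have b_smooth: "smooth_on UNIV b"
    unfolding b_def by (rule smooth_on_compose[OF B \<gamma>_smooth \<gamma>])
  have "smooth_on tr_domain E"
    unfolding E_def
    by (intro smooth_on_mult smooth_on_diff smooth_on_power smooth_on_const smooth_on_x_deriv B)
  then have f_smooth: "smooth_on UNIV f"
    unfolding f_def by (rule smooth_on_compose[OF _ \<gamma>_smooth \<gamma>])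
  \<comment> \<open>The sign of \<open>B\<^sub>x\<close>, obtained from \<open>A > 0\<close> through
    the first equation, selects the positive square root later.\<close>
  have pos: "B (tr_of_xy x y) > 0" "x_deriv B (tr_of_xy x y) > 0" if "x \<in> char_line y" for x y
  proof -
    have p: "tr_of_xy x y \<in> tr_domain" using that by (simp add: char_line_def)
    show "B (tr_of_xy x y) > 0" by (rule Bpos[OF p])
    moreover have "2 * B (tr_of_xy x y) * x_deriv B (tr_of_xy x y) > 0"
      using solves that Apos[OF p] unfolding solves_system_iff by simp
    ultimately show "x_deriv B (tr_of_xy x y) > 0" by (simp add: zero_less_mult_iff)
  qed
  have E: "E (tr_of_xy x y) = f y" if x: "x \<in> char_line y" for x y
  proof -
    have "((\<lambda>x. E (tr_of_xy x y)) has_real_derivative 0) (at x within char_line y)"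
      if x: "x \<in> char_line y" for x
    proof -
      let ?b = "B (tr_of_xy x y)" and ?b' = "x_deriv B (tr_of_xy x y)"
        and ?b'' = "x_deriv (x_deriv B) (tr_of_xy x y)"
      have "((\<lambda>x. E (tr_of_xy x y)) has_real_derivative
          3 * ?b\<^sup>2 * ?b' * (?b'\<^sup>2 - 1/12) + ?b ^ 3 * (2 * ?b' * ?b'')) (at x within char_line y)"
        unfolding E_def
        by (auto intro!: derivative_eq_intros has_real_derivative_x_deriv smooth_on_x_deriv B x
            simp: algebra_simps)
      \<comment> \<open>The derivative of \<open>E\<close> is a multiple of the defect in the second
        equation, hence zero.\<close>
      moreover have "3 * ?b\<^sup>2 * ?b' * (?b'\<^sup>2 - 1/12) + ?b ^ 3 * (2 * ?b' * ?b'')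
          = ?b\<^sup>2 * ?b' / 4 * (8 * ?b * ?b'' + 12 * ?b'\<^sup>2 - 1)"
        by (simp add: algebra_simps power2_eq_square power3_eq_cube)
      moreover have "8 * ?b * ?b'' + 12 * ?b'\<^sup>2 = 1"
        using solves x unfolding solves_system_iff by blast
      ultimately show ?thesis by simp
    qed
    from constant_on_char_line[OF this x X] show ?thesis by (simp add: f_def \<gamma>_def)
  qed
  \<comment> \<open>This is the conservation law solved for \<open>B\<^sub>x\<close> squared. The
    radicand is therefore positive, so that \<open>B\<close> stays strictly above the threshold,
    where the profile integral is differentiable.\<close>
  have Bx: "1/12 + f y / B (tr_of_xy x y) ^ 3 = (x_deriv B (tr_of_xy x y))\<^sup>2"
    if "x \<in> char_line y" for x y
    using pos(1)[OF that] unfolding E[OF that, symmetric] E_def by simp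
  have t: "threshold (f y) < B (tr_of_xy x y)" if "x \<in> char_line y" for x y
    using pos[OF that] by (simp add: less_threshold_iff Bx[OF that])
  have eq: "x = profile_integral (f y) (B (tr_of_xy x y)) + h y" if x: "x \<in> char_line y" for x y
  proof -
    have "((\<lambda>x. x - profile_integral (f y) (B (tr_of_xy x y))) has_real_derivative 0)
        (at x within char_line y)"
      if x: "x \<in> char_line y" for x
    proof -
      have "integrand (f y) (B (tr_of_xy x y)) * x_deriv B (tr_of_xy x y) = 1"
        using pos(2)[OF x] by (simp add: integrand_def Bx[OF x])
      then show ?thesis
        using DERIV_diff[OF DERIV_ident has_real_derivative_profile_integral_line[OF B x t[OF x]]]
        by simp
    qed
    from constant_on_char_line[OF this x X] show ?thesis by (simp add: h_def b_def \<gamma>_def)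
  qed
  show ?thesis
  proof (intro exI conjI)
    have bt: "b y > 0" "threshold (f y) < b y" for y
      using pos(1)[OF X] t[OF X] by (simp_all add: b_def \<gamma>_def)
    have "continuous_on UNIV h"
      unfolding h_def
      by (intro continuous_on_diff smooth_on_imp_continuous_on[OF X_smooth]
          continuous_on_profile_integral_compose f_smooth b_smooth bt)
    moreover have "smooth_on (- frontier {y. f y = 0}) h"
      unfolding h_def
      by (intro smooth_on_diff smooth_on_subset[OF X_smooth] subset_UNIV
          smooth_on_profile_integral_frontier f_smooth b_smooth bt)
    ultimately show "admissible_data f h" using f_smooth by (simp add: admissible_data_def)
    have "A (tr_of_xy x y) = 2 * B (tr_of_xy x y) * sqrt (1/12 + f y / B (tr_of_xy x y) ^ 3)"
      if "x \<in> char_line y" for x y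
      using solves that pos(2)[OF that] unfolding Bx[OF that] solves_system_iff by simp
    with eq show "given_by f h A B" unfolding given_by_iff by blast
  qed
qed

theorem lemma2:
  fixes A B :: "real \<times> real \<Rightarrow> real"
  assumes "smooth_on tr_domain A" and "smooth_on tr_domain B"
    and "\<And>p. p \<in> tr_domain \<Longrightarrow> A p > 0" and "\<And>p. p \<in> tr_domain \<Longrightarrow> B p > 0"
  shows "solves_system A B \<longleftrightarrow> (\<exists>f h. admissible_data f h \<and> given_by f h A B)"
proof
  assume "solves_system A B"
  from solves_system_imp_given_by[OF assms(2) _ _ this]
  show "\<exists>f h. admissible_data f h \<and> given_by f h A B" by (simp add: assms)
next
  assume "\<exists>f h. admissible_data f h \<and> given_by f h A B"
  then obtain f h where "given_by f h A B" by blast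
  from given_by_imp_solves_system[OF assms(2) _ _ this]
  show "solves_system A B" by (simp add: assms)
qed

end
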